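(* Let $x^\dagger\in N(A)^\perp$ and $x_{n,m}:=A_{n,m}^\dagger Ax^\dagger$. (1) Suppose that there are a constant $C$ and, for each $(n,m)\in\mathbb{N}\times\mathbb{N}$, indices $\tilde n_{n,m},\tilde m_{n,m}\in\mathbb{N}$ with $\lim_{n,m\to\infty}\tilde n_{n,m}=\infty$, $\tilde m_{n,m}\ge m$ and $\tilde n_{n,m}\le n$, such that $$\sup_{n,m}\|x_{n,m}\|<C\quad\text{and}\quad\sup_{n,m}\big\|A^*\big(A_{\tilde n_{n,m},\tilde m_{n,m}}^*\big)^\dagger x_{n,m}\big\|<C.$$ Then $x_{n,m}\rightharpoonup x^\dagger$ as $n,m\to\infty$. (2) If one can choose $\tilde n_{n,m}=n$ and $\tilde m_{n,m}=m$, i.e. if for some constant $C$ $$\sup_{n,m}\|x_{n,m}\|<C\quad\text{and}\quad\sup_{n,m}\big\|A^*(A_{n,m}^* )^\dagger x_{n,m}\big\|<C,$$ then $x_{n,m}\to x^\dagger$ as $n,m\to\infty$.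
   Context: $X,Y$ are Hilbert spaces and $A:X\to Y$ is a bounded linear operator. $(X_n)_{n\in\mathbb{N}}$ and $(Y_m)_{m\in\mathbb{N}}$ are sequences of finite-dimensional subspaces $X_n\subset X$, $Y_m\subset Y$ with $X_n\subset X_{n+1}$, $\overline{\bigcup_n X_n}=X$, $Y_m\subset Y_{m+1}$, $\overline{\bigcup_m Y_m}=Y$. $P_n$ is the orthogonal projector of $X$ onto $X_n$ and $Q_m$ the orthogonal projector of $Y$ onto $Y_m$. $A_{n,m}:=Q_mAP_n:X\to Y$ (first index: the space $X_n$; second index: the space $Y_m$), and $A_{n,m}^*=P_nA^*Q_m$ is its adjoint. $N(T)$ denotes the nullspace of an operator $T$, and $T^\dagger$ the Moore–Penrose pseudoinverse of an operator $T$ with closed range ($T^\dagger y$ is the minimum-norm least-squares solution of $Tx=y$). $\to$ denotes norm convergence and $\rightharpoonup$ weak convergence; "as $n,m\to\infty$" means the joint limit with both indices tending to infinity independently. *)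

theory Defs
  imports "HOL-Analysis.Analysis"
begin

(* Hilbert spaces are types of sort {real_inner, complete_space}.  This covers complex Hilbert
   spaces too: with the real inner product Re <x,y>, all notions below agree with their complex
   versions for complex subspaces and complex-linear operators. *)

definition nullspace :: "('a::real_vector \<Rightarrow> 'b::real_vector) \<Rightarrow> 'a set" where
  "nullspace T = {x. T x = 0}"

(* The library function dim cannot be used here: it is 0 for infinite-dimensional spaces. *)
definition finite_dim_subspace :: "'a::real_vector set \<Rightarrow> bool" where
  "finite_dim_subspace S \<longleftrightarrow> (\<exists>B. finite B \<and> S = span B)"

(* Well defined if S is a complete subspace, in particular if it is finite-dimensional. *)
definition orth_proj :: "'a::real_inner set \<Rightarrow> 'a \<Rightarrow> 'a" where
  "orth_proj S x = (THE p. p \<in> S \<and> x - p \<in> orthogonal_comp S)"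

definition least_squares_sol ::
    "('a::real_inner \<Rightarrow> 'b::real_inner) \<Rightarrow> 'b \<Rightarrow> 'a \<Rightarrow> bool" where
  "least_squares_sol T y x \<longleftrightarrow> (\<forall>z. norm (T x - y) \<le> norm (T z - y))"

(* Moore-Penrose pseudoinverse; well defined for bounded linear T with closed range between
   Hilbert spaces. *)
definition pseudoinverse ::
    "('a::real_inner \<Rightarrow> 'b::real_inner) \<Rightarrow> 'b \<Rightarrow> 'a" where
  "pseudoinverse T y =
    (THE x. least_squares_sol T y x \<and> (\<forall>z. least_squares_sol T y z \<longrightarrow> norm x \<le> norm z))"

definition discretized_op ::
    "('a::real_inner \<Rightarrow> 'b::real_inner) \<Rightarrow> (nat \<Rightarrow> 'a set) \<Rightarrow> (nat \<Rightarrow> 'b set) \<Rightarrow>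
      nat \<Rightarrow> nat \<Rightarrow> 'a \<Rightarrow> 'b" where
  "discretized_op A X Y n m = orth_proj (Y m) \<circ> A \<circ> orth_proj (X n)"

definition discretized_sol ::
    "('a::real_inner \<Rightarrow> 'b::real_inner) \<Rightarrow> (nat \<Rightarrow> 'a set) \<Rightarrow> (nat \<Rightarrow> 'b set) \<Rightarrow>
      'a \<Rightarrow> nat \<Rightarrow> nat \<Rightarrow> 'a" where
  "discretized_sol A X Y xd n m = pseudoinverse (discretized_op A X Y n m) (A xd)"

definition weakly_tendsto :: "('i \<Rightarrow> 'a::real_normed_vector) \<Rightarrow> 'a \<Rightarrow> 'i filter \<Rightarrow> bool" where
  "weakly_tendsto f l F \<longleftrightarrow>
    (\<forall>\<phi> :: 'a \<Rightarrow> real. bounded_linear \<phi> \<longrightarrow> ((\<lambda>i. \<phi> (f i)) \<longlongrightarrow> \<phi> l) F)"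

end

theory Submission
  imports Defs
begin

text \<open>Write \<open>x\<close> for the discrete solution and \<open>u\<close> for the pseudoinverse of the adjoint of the
  operator with indices \<open>n', m'\<close> applied to \<open>x\<close>. The normal equations for \<open>x\<close> and its boundedness
  give \<open>A\<^sup>* A (x - xd) \<rightharpoonup> 0\<close>. Moreover \<open>x - A\<^sup>* u\<close> is bounded and orthogonal to \<open>X n'\<close>, so it tends
  weakly to 0; as \<open>A\<^sup>* u\<close> is orthogonal to the nullspace of \<open>A\<close>, so is \<open>x\<close> in the limit. Hence
  \<open>inner (x - xd) v\<close> tends to 0 for \<open>v\<close> in the nullspace of \<open>A\<close> and in the range of \<open>A\<^sup>* A\<close>, which
  together span a dense subspace. If \<open>n' = n\<close> and \<open>m' = m\<close>, then
  \<open>norm x ^ 2 = inner (A\<^sup>* u) xd \<longlonglongrightarrow> norm xd ^ 2\<close>, and weak convergence becomes strong.\<close>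

section \<open>Projection theorem, Riesz representation and adjoints in Hilbert space\<close>

text \<open>A minimizing sequence for the squared distance to \<open>x\<close> is Cauchy by the
  parallelogram law; its limit attains the distance, and minimality forces orthogonality.\<close>

lemma closed_subspace_projection:
  fixes x :: "'a::{real_inner, complete_space}"
  assumes S: "subspace S" "closed S"
  shows "\<exists>p\<in>S. \<forall>s\<in>S. inner (x - p) s = 0"
proof -
  let ?f = "\<lambda>s. (norm (x - s))\<^sup>2"
  define D where "D = (INF s\<in>S. ?f s)"
  have bdd: "bdd_below (?f ` S)" by (rule bdd_belowI[of _ 0]) auto
  have D_le: "D \<le> ?f s" if "s \<in> S" for s
    unfolding D_def using bdd that by (rule cINF_lower)
  have "\<exists>s\<in>S. ?f s < D + inverse (real (Suc n))" for n
    using cINF_less_iff[of S ?f "D + inverse (real (Suc n))"] bdd subspace_0[OF S(1)]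
    unfolding D_def by auto
  then obtain s where sS: "\<And>n. s n \<in> S"
    and s_lt: "\<And>n. ?f (s n) < D + inverse (real (Suc n))"
    by metis
  \<comment> \<open>Parallelogram law for \<open>x - s m\<close> and \<open>x - s n\<close>; the
    midpoint of \<open>s m\<close> and \<open>s n\<close> lies in \<open>S\<close>, so its squared
    distance to \<open>x\<close> is at least \<open>D\<close>.\<close>
  have close: "(dist (s m) (s n))\<^sup>2 \<le> 2 * (inverse (real (Suc m)) + inverse (real (Suc n)))" for m n
  proof -
    have "(1/2) *\<^sub>R (s m + s n) \<in> S"
      using S(1) sS by (intro subspace_scale subspace_add)
    from D_le[OF this] have "4 * D \<le> 4 * ?f ((1/2) *\<^sub>R (s m + s n))" by simp
    moreover have "(dist (s m) (s n))\<^sup>2 + 4 * ?f ((1/2) *\<^sub>R (s m + s n))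
        = 2 * ?f (s m) + 2 * ?f (s n)"
      unfolding dist_norm power2_norm_eq_inner
      by (simp add: inner_diff_left inner_diff_right inner_add_left inner_add_right
          inner_commute algebra_simps)
    ultimately show ?thesis using s_lt[of m] s_lt[of n] by argo
  qed
  have "Cauchy s"
  proof (rule metric_CauchyI)
    fix e :: real assume "e > 0"
    then obtain N where N: "inverse (real (Suc N)) < e\<^sup>2 / 4"
      using reals_Archimedean[of "e\<^sup>2 / 4"] by auto
    have "dist (s m) (s n) < e" if "m \<ge> N" "n \<ge> N" for m n
    proof -
      have "inverse (real (Suc k)) \<le> inverse (real (Suc N))" if "k \<ge> N" for k
        using that by (intro le_imp_inverse_le) auto
      from this[OF that(1)] this[OF that(2)] have "(dist (s m) (s n))\<^sup>2 < e\<^sup>2"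
        using close[of m n] N by argo
      then show ?thesis using \<open>e > 0\<close> by (intro power2_less_imp_less[of _ e]) auto
    qed
    then show "\<exists>M. \<forall>m\<ge>M. \<forall>n\<ge>M. dist (s m) (s n) < e" by blast
  qed
  then obtain p where p: "s \<longlonglongrightarrow> p" using Cauchy_convergent_iff convergent_def by blast
  have pS: "p \<in> S" using S(2) sS p by (meson closed_sequentially)
  have "(\<lambda>n. D + inverse (real (Suc n))) \<longlonglongrightarrow> D + 0"
    by (intro tendsto_intros LIMSEQ_inverse_real_of_nat)
  moreover have "(\<lambda>n. ?f (s n)) \<longlonglongrightarrow> ?f p" by (intro tendsto_intros p)
  ultimately have p_min: "?f p \<le> D"
    using s_lt by (intro LIMSEQ_le[of "\<lambda>n. ?f (s n)" _ "\<lambda>n. D + inverse (real (Suc n))"])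
      (auto simp del: of_nat_Suc intro: less_imp_le)
  have "inner (x - p) s = 0" if s: "s \<in> S" for s
  proof (cases "s = 0")
    case False
    \<comment> \<open>This \<open>t\<close> minimizes the quadratic
      \<open>?f (p + t *\<^sub>R s)\<close>, which then drops by exactly
      \<open>t * inner (x - p) s\<close>.\<close>
    define t where "t = inner (x - p) s / inner s s"
    have "p + t *\<^sub>R s \<in> S" using S(1) pS s by (intro subspace_scale subspace_add)
    then have "?f p \<le> ?f (p + t *\<^sub>R s)" using D_le p_min by (meson order_trans)
    also have "\<dots> = ?f p - 2 * t * inner (x - p) s + t * (t * inner s s)"
      unfolding power2_norm_eq_inner
      by (simp add: inner_diff_left inner_diff_right inner_add_left inner_add_right
          inner_commute algebra_simps)
    also have "t * inner s s = inner (x - p) s" using False by (simp add: t_def)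
    finally have "t * inner (x - p) s \<le> 0" by simp
    then have "(inner (x - p) s)\<^sup>2 / inner s s \<le> 0" by (simp add: t_def power2_eq_square)
    moreover have "inner s s > 0" using False by simp
    ultimately have "(inner (x - p) s)\<^sup>2 \<le> 0" by (simp add: divide_le_0_iff)
    then show ?thesis by simp
  qed simp
  with pS show ?thesis by blast
qed

text \<open>A vector \<open>w\<close> normal to the kernel represents \<open>\<phi>\<close> up to
  scaling, because every \<open>z\<close> differs from a multiple of \<open>w\<close> by an element
  of the kernel.\<close>

lemma riesz_representation:
  fixes \<phi> :: "'a::{real_inner, complete_space} \<Rightarrow> real"
  assumes "bounded_linear \<phi>"
  shows "\<exists>v. \<forall>x. \<phi> x = inner x v"
proof (cases "\<forall>x. \<phi> x = 0")
  case False
  then obtain x where x: "\<phi> x \<noteq> 0" by blast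
  interpret bounded_linear \<phi> by fact
  let ?N = "{z. \<phi> z = 0}"
  have "subspace ?N" by (auto simp: subspace_def zero add scaleR)
  moreover have "closed ?N"
    by (intro closed_Collect_eq continuous_intros linear_continuous_on assms)
  ultimately obtain p where p: "\<phi> p = 0" "\<And>s. \<phi> s = 0 \<Longrightarrow> inner (x - p) s = 0"
    using closed_subspace_projection[of ?N x] by blast
  define w where "w = x - p"
  have w: "\<phi> w \<noteq> 0" using x p(1) by (simp add: w_def diff)
  then have "w \<noteq> 0" using zero by auto
  have "\<phi> z = inner z ((\<phi> w / inner w w) *\<^sub>R w)" for z
  proof -
    have "\<phi> (z - (\<phi> z / \<phi> w) *\<^sub>R w) = 0" using w by (simp add: diff scaleR)
    from p(2)[OF this] have "inner z w = \<phi> z / \<phi> w * inner w w"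
      by (simp add: w_def[symmetric] inner_diff_right inner_commute)
    then show ?thesis using w \<open>w \<noteq> 0\<close> by simp
  qed
  then show ?thesis by blast
qed (auto intro: exI[of _ 0])

text \<open>\<open>adjoint\<close> is defined by choice, so its characteristic equation rests on the
  existence of some adjoint, which Riesz representation of \<open>inner (A x) y\<close> in
  \<open>x\<close> provides.\<close>

lemma inner_adjoint:
  fixes A :: "'a::{real_inner, complete_space} \<Rightarrow> 'b::real_inner"
  assumes "bounded_linear A"
  shows "inner (A x) y = inner x (adjoint A y)"
proof -
  have "bounded_linear (\<lambda>x. inner (A x) y)" for y
    using bounded_linear_compose[OF bounded_linear_inner_left assms] .
  then have "\<forall>y. \<exists>v. \<forall>x. inner (A x) y = inner x v" using riesz_representation by blast
  then obtain g where g: "\<forall>x y. inner (A x) y = inner x (g y)" by metis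
  then show ?thesis using adjoint_unique[OF g] by simp
qed

lemma linear_if_adjoint:
  fixes f :: "'a::real_inner \<Rightarrow> 'b::real_inner"
  assumes adj: "\<And>x y. inner (f x) y = inner x (g y)"
  shows "linear f"
proof (rule linearI)
  fix x y and c :: real
  have "inner (f (x + y)) z = inner (f x + f y) z" for z
    by (simp add: adj inner_add_left)
  then show "f (x + y) = f x + f y" using vector_eq_rdot by blast
  have "inner (f (c *\<^sub>R x)) z = inner (c *\<^sub>R f x) z" for z
    by (simp add: adj)
  then show "f (c *\<^sub>R x) = c *\<^sub>R f x" using vector_eq_rdot by blast
qed

section \<open>Finite-dimensional subspaces and their orthogonal projectors\<close>

lemma finite_dim_subspace_imp_subspace: "finite_dim_subspace S \<Longrightarrow> subspace S"
  by (auto simp: finite_dim_subspace_def)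

lemma finite_dim_subspace_image:
  assumes "linear f" "finite_dim_subspace S"
  shows "finite_dim_subspace (f ` S)"
  using assms unfolding finite_dim_subspace_def
  by (metis finite_imageI linear_span_image)

text \<open>Gram-Schmidt yields an orthogonal spanning set, and the Fourier sum over it is the
  projection; completeness of the whole space is not assumed.\<close>

lemma finite_dim_projection:
  fixes S :: "'a::real_inner set"
  assumes "finite_dim_subspace S"
  shows "\<exists>p\<in>S. \<forall>s\<in>S. inner (x - p) s = 0"
proof -
  obtain B where B: "finite B" "S = span B" using assms by (auto simp: finite_dim_subspace_def)
  obtain C where C: "finite C" "span C = S" "pairwise orthogonal C"
    using basis_orthogonal[OF B(1)] B(2) by blast
  let ?p = "\<Sum>b\<in>C. (inner b x / inner b b) *\<^sub>R b"
  have "?p \<in> S" unfolding C(2)[symmetric] by (intro span_sum span_scale span_base)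
  moreover have "inner (x - ?p) c = 0" if "c \<in> C" for c
  proof -
    have "inner ?p c = (\<Sum>b\<in>C. if b = c then inner x c else 0)"
      unfolding inner_sum_left
    proof (rule sum.cong)
      fix b assume "b \<in> C"
      then have "b \<noteq> c \<Longrightarrow> inner b c = 0"
        using C(3) that by (simp add: pairwise_def orthogonal_def)
      then show "inner ((inner b x / inner b b) *\<^sub>R b) c = (if b = c then inner x c else 0)"
        \<comment> \<open>\<open>C\<close> may contain the zero vector, for which the quotient is
          not 1 but both sides vanish.\<close>
        by (cases "c = 0") (auto simp: inner_commute)
    qed simp
    also have "\<dots> = inner x c" using C(1) that by simp
    finally show ?thesis by (simp add: inner_diff_left)
  qed
  then have "span C \<subseteq> {s. inner (x - ?p) s = 0}"
    by (intro span_minimal) (auto simp: subspace_def inner_add_right)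
  ultimately show ?thesis using C(2) by blast
qed

text \<open>The description by \<open>THE\<close> is legitimate: two candidates differ by a vector
  of \<open>S\<close> that is orthogonal to itself.\<close>

lemma orth_proj_props:
  assumes "finite_dim_subspace S"
  shows orth_proj_mem: "orth_proj S x \<in> S"
    and inner_diff_orth_proj: "s \<in> S \<Longrightarrow> inner (x - orth_proj S x) s = 0"
proof -
  obtain p where p: "p \<in> S" "\<And>s. s \<in> S \<Longrightarrow> inner (x - p) s = 0"
    using finite_dim_projection[OF assms] by blast
  have "orth_proj S x = p" unfolding orth_proj_def
  proof (rule the_equality)
    show "p \<in> S \<and> x - p \<in> orthogonal_comp S"
      using p by (auto simp: orthogonal_comp_def orthogonal_def inner_commute)
    fix q assume q: "q \<in> S \<and> x - q \<in> orthogonal_comp S"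
    have d: "p - q \<in> S"
      using q p finite_dim_subspace_imp_subspace[OF assms] by (simp add: subspace_diff)
    have "inner (x - q) (p - q) = 0"
      using q d by (auto simp: orthogonal_comp_def orthogonal_def inner_commute)
    with p(2)[OF d] have "inner (p - q) (p - q) = 0" by (simp add: inner_diff_left)
    then show "q = p" by simp
  qed
  then show "orth_proj S x \<in> S" "s \<in> S \<Longrightarrow> inner (x - orth_proj S x) s = 0"
    using p by auto
qed

context
  fixes S :: "'a::real_inner set"
  assumes S: "finite_dim_subspace S"
begin

lemma inner_orth_proj: "s \<in> S \<Longrightarrow> inner (orth_proj S x) s = inner x s"
  using inner_diff_orth_proj[OF S, of s x] by (simp add: inner_diff_left)

lemma orth_proj_self_adjoint: "inner (orth_proj S x) y = inner x (orth_proj S y)"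
  using inner_orth_proj orth_proj_mem[OF S] by (metis inner_commute)

lemma linear_orth_proj: "linear (orth_proj S)"
  using orth_proj_self_adjoint by (rule linear_if_adjoint)

lemma orth_proj_ident:
  assumes "x \<in> S" shows "orth_proj S x = x"
proof -
  have "orth_proj S x - x \<in> S"
    using assms orth_proj_mem[OF S] finite_dim_subspace_imp_subspace[OF S]
    by (simp add: subspace_diff)
  from inner_orth_proj[OF this, of x] have "inner (orth_proj S x - x) (orth_proj S x - x) = 0"
    by (simp add: inner_diff_left)
  then show ?thesis by simp
qed

lemma range_orth_proj: "range (orth_proj S) = S"
  using orth_proj_mem[OF S] orth_proj_ident by (auto intro!: image_eqI[OF sym])

text \<open>Pythagoras for the splitting of \<open>x - s\<close> into \<open>x - ?p\<close>,
  orthogonal to \<open>S\<close>, and \<open>?p - s\<close> in \<open>S\<close>.\<close>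

lemma dist_orth_proj_le:
  assumes "s \<in> S" shows "dist (orth_proj S x) x \<le> dist s x"
proof -
  let ?p = "orth_proj S x"
  have "?p - s \<in> S"
    using assms orth_proj_mem[OF S] finite_dim_subspace_imp_subspace[OF S]
    by (simp add: subspace_diff)
  then have "orthogonal (x - ?p) (?p - s)"
    unfolding orthogonal_def by (rule inner_diff_orth_proj[OF S])
  from norm_add_Pythagorean[OF this]
  have "(norm (x - s))\<^sup>2 = (norm (x - ?p))\<^sup>2 + (norm (?p - s))\<^sup>2" by simp
  then have "(norm (x - ?p))\<^sup>2 \<le> (norm (x - s))\<^sup>2" by simp
  then have "norm (x - ?p) \<le> norm (x - s)" by (rule power2_le_imp_le) simp
  then show ?thesis by (metis dist_commute dist_norm)
qed

end

text \<open>A point of some \<open>X N\<close> close to \<open>v\<close> stays in all later spaces,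
  where the projection of \<open>v\<close> is at least as close.\<close>

lemma orth_proj_tendsto:
  fixes X :: "nat \<Rightarrow> 'a::real_inner set"
  assumes "\<And>n. finite_dim_subspace (X n)" "\<And>n. X n \<subseteq> X (Suc n)"
    and "closure (\<Union>n. X n) = UNIV"
  shows "(\<lambda>n. orth_proj (X n) v) \<longlonglongrightarrow> v"
proof (rule metric_LIMSEQ_I)
  fix e :: real assume "e > 0"
  have "v \<in> closure (\<Union>n. X n)" using assms(3) by simp
  then obtain s N where s: "s \<in> X N" "dist s v < e"
    using \<open>e > 0\<close> unfolding closure_approachable by blast
  have "dist (orth_proj (X n) v) v < e" if "n \<ge> N" for n
  proof -
    have "s \<in> X n" using lift_Suc_mono_le[of X, OF assms(2) that] s(1) by blast
    from dist_orth_proj_le[OF assms(1) this, of v] s(2) show ?thesis by simp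
  qed
  then show "\<exists>N. \<forall>n\<ge>N. dist (orth_proj (X n) v) v < e" by blast
qed

section \<open>The Moore-Penrose pseudoinverse of a finite-rank operator\<close>

text \<open>Projecting \<open>y\<close> onto the range of \<open>T\<close> gives a least-squares
  solution \<open>x0\<close>; projecting \<open>x0\<close> onto the range of \<open>T'\<close> makes
  its norm minimal. As \<open>T'\<close> is any formal adjoint, the lemma applies to an operator
  and, with the roles exchanged, to its adjoint.\<close>

lemma pseudoinverse_props:
  fixes T :: "'a::real_inner \<Rightarrow> 'b::real_inner"
  assumes adj: "\<And>x y. inner (T x) y = inner x (T' y)"
    and fin: "finite_dim_subspace (range T)" "finite_dim_subspace (range T')"
  shows pseudoinverse_mem_range: "pseudoinverse T y \<in> range T'"
    and pseudoinverse_normal_eq: "T' (T (pseudoinverse T y) - y) = 0"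
proof -
  have linT: "linear T" using adj by (rule linear_if_adjoint)
  obtain x0 where x0: "\<And>z. inner (y - T x0) (T z) = 0"
    using finite_dim_projection[OF fin(1), of y] by blast
  obtain x where x: "x \<in> range T'" "\<And>z. inner (x0 - x) (T' z) = 0"
    using finite_dim_projection[OF fin(2), of x0] by blast
  \<comment> \<open>Moving one \<open>T\<close> across gives
    \<open>inner (x0 - x) (T' (T (x0 - x)))\<close>, which vanishes by the choice of
    \<open>x\<close>.\<close>
  have "inner (T (x0 - x)) (T (x0 - x)) = 0"
    using x(2) by (simp add: adj)
  then have "T x = T x0" by (simp add: linear_diff[OF linT])
  with x0 have res: "inner (T x - y) (T z) = 0" for z
    by (metis inner_minus_left minus_diff_eq neg_0_equal_iff_equal)
  have pyth: "(norm (T z - y))\<^sup>2 = (norm (T x - y))\<^sup>2 + (norm (T z - T x))\<^sup>2" for z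
  proof -
    have "orthogonal (T x - y) (T z - T x)"
      using res[of "z - x"] by (simp add: orthogonal_def linear_diff[OF linT])
    from norm_add_Pythagorean[OF this] show ?thesis by simp
  qed
  have ls: "least_squares_sol T y x" unfolding least_squares_sol_def
  proof
    fix z
    have "(norm (T x - y))\<^sup>2 \<le> (norm (T z - y))\<^sup>2" unfolding pyth[of z] by simp
    then show "norm (T x - y) \<le> norm (T z - y)" by (rule power2_le_imp_le) simp
  qed
  \<comment> \<open>Any other least-squares solution differs from \<open>x\<close> by a vector in
    the nullspace of \<open>T\<close>, which is orthogonal to the range of \<open>T'\<close>. This
    yields both minimality and uniqueness.\<close>
  have pyth2: "(norm z)\<^sup>2 = (norm x)\<^sup>2 + (norm (z - x))\<^sup>2" if "least_squares_sol T y z" for z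
  proof -
    have "norm (T z - y) \<le> norm (T x - y)" using that by (auto simp: least_squares_sol_def)
    then have "(norm (T z - y))\<^sup>2 \<le> (norm (T x - y))\<^sup>2" by (simp add: power_mono)
    then have "T (z - x) = 0" using pyth[of z] by (simp add: linear_diff[OF linT])
    moreover obtain w where "x = T' w" using x(1) by blast
    ultimately have "orthogonal x (z - x)"
      unfolding orthogonal_def using adj[of "z - x" w] by (simp add: inner_commute)
    from norm_add_Pythagorean[OF this] show ?thesis by simp
  qed
  have "pseudoinverse T y = x" unfolding pseudoinverse_def
  proof (rule the_equality)
    have "norm x \<le> norm z" if "least_squares_sol T y z" for z
    proof (rule power2_le_imp_le)
      show "(norm x)\<^sup>2 \<le> (norm z)\<^sup>2" unfolding pyth2[OF that] by simp
    qed simp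
    with ls show "least_squares_sol T y x \<and> (\<forall>z. least_squares_sol T y z \<longrightarrow> norm x \<le> norm z)"
      by blast
    fix z assume z: "least_squares_sol T y z \<and> (\<forall>z'. least_squares_sol T y z' \<longrightarrow> norm z \<le> norm z')"
    then have "norm z \<le> norm x" using ls by blast
    then have "(norm z)\<^sup>2 \<le> (norm x)\<^sup>2" by (simp add: power_mono)
    then show "z = x" using pyth2[of z] z by simp
  qed
  moreover have "inner (T' (T x - y)) (T' (T x - y)) = 0"
    using res[of "T' (T x - y)"] adj[of "T' (T x - y)" "T x - y"] by (simp add: inner_commute)
  ultimately show "pseudoinverse T y \<in> range T'" "T' (T (pseudoinverse T y) - y) = 0"
    using x(1) by auto
qed

section \<open>Weak and strong convergence along a filter\<close>

lemma inner_tendsto_0_bounded: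
  fixes g h :: "'i \<Rightarrow> 'a::real_inner"
  assumes "\<And>i. norm (g i) \<le> K" "(h \<longlongrightarrow> 0) F"
  shows "((\<lambda>i. inner (g i) (h i)) \<longlongrightarrow> 0) F"
proof (rule Lim_null_comparison)
  show "\<forall>\<^sub>F i in F. norm (inner (g i) (h i)) \<le> K * norm (h i)"
    using assms(1) by (intro always_eventually allI)
      (simp, meson Cauchy_Schwarz_ineq2 mult_right_mono norm_ge_zero order_trans)
  show "((\<lambda>i. K * norm (h i)) \<longlongrightarrow> 0) F"
    using assms(2) by (intro tendsto_mult_right_zero tendsto_norm_zero)
qed

text \<open>For a bounded family, convergence of the pairings to 0 thus only has to be checked on
  vectors whose span is dense.\<close>

lemma closed_subspace_weak_null:
  fixes g :: "'i \<Rightarrow> 'a::real_inner" and F :: "'i filter"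
  assumes g: "\<And>i. norm (g i) \<le> K"
  defines "V \<equiv> {v. ((\<lambda>i. inner (g i) v) \<longlongrightarrow> 0) F}"
  shows "subspace V" "closed V"
proof -
  show "subspace V" unfolding subspace_def V_def
    by (auto simp: inner_add_right intro: tendsto_add_zero tendsto_mult_right_zero)
  show "closed V" unfolding closed_sequential_limits
  proof (intro allI impI, elim conjE)
    fix s v assume s: "\<forall>n. s n \<in> V" "s \<longlonglongrightarrow> v"
    have "((\<lambda>i. inner (g i) v) \<longlongrightarrow> 0) F"
    proof (rule tendstoI)
      fix e :: real assume "e > 0"
      have "(\<lambda>n. K * norm (s n - v)) \<longlonglongrightarrow> K * norm (v - v)" by (intro tendsto_intros s(2))
      then have "(\<lambda>n. K * norm (s n - v)) \<longlonglongrightarrow> 0" by simp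
      then have "eventually (\<lambda>n. K * norm (s n - v) < e / 2) sequentially"
        using \<open>e > 0\<close> by (intro order_tendstoD(2)) auto
      then obtain n where n: "K * norm (s n - v) < e / 2"
        by (auto simp: eventually_sequentially)
      have "((\<lambda>i. inner (g i) (s n)) \<longlongrightarrow> 0) F" using s(1) by (simp add: V_def)
      from tendstoD[OF this, of "e / 2"]
      have "eventually (\<lambda>i. \<bar>inner (g i) (s n)\<bar> < e / 2) F" using \<open>e > 0\<close> by (simp add: dist_norm)
      then show "eventually (\<lambda>i. dist (inner (g i) v) 0 < e) F"
      proof eventually_elim
        case (elim i)
        have "\<bar>inner (g i) (s n - v)\<bar> \<le> K * norm (s n - v)"
          using Cauchy_Schwarz_ineq2[of "g i" "s n - v"] g[of i]
          by (meson mult_right_mono norm_ge_zero order_trans)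
        with n elim show ?case by (simp add: dist_norm inner_diff_right)
      qed
    qed
    then show "v \<in> V" by (simp add: V_def)
  qed
qed

lemma weakly_tendsto_if_inner_tendsto:
  fixes f :: "'i \<Rightarrow> 'a::{real_inner, complete_space}"
  assumes "\<And>v. ((\<lambda>i. inner (f i - l) v) \<longlongrightarrow> 0) F"
  shows "weakly_tendsto f l F"
  unfolding weakly_tendsto_def
proof (intro allI impI)
  fix \<phi> :: "'a \<Rightarrow> real" assume "bounded_linear \<phi>"
  then obtain v where "\<And>x. \<phi> x = inner x v" using riesz_representation by blast
  then show "((\<lambda>i. \<phi> (f i)) \<longlongrightarrow> \<phi> l) F"
    using assms[of v] by (simp add: inner_diff_left LIM_zero_iff)
qed

text \<open>The Radon-Riesz property, by expanding the square of
  \<open>norm (f i - l)\<close>.\<close>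

lemma tendsto_if_weak_and_norm:
  fixes f :: "'i \<Rightarrow> 'a::real_inner"
  assumes weak: "((\<lambda>i. inner (f i) l) \<longlongrightarrow> inner l l) F"
    and norm: "((\<lambda>i. inner (f i) (f i)) \<longlongrightarrow> inner l l) F"
  shows "(f \<longlongrightarrow> l) F"
proof -
  have "((\<lambda>i. inner (f i) (f i) - 2 * inner (f i) l + inner l l) \<longlongrightarrow>
      inner l l - 2 * inner l l + inner l l) F"
    by (intro tendsto_intros assms)
  moreover have "inner (f i) (f i) - 2 * inner (f i) l + inner l l = (norm (f i - l))\<^sup>2" for i
    by (simp add: power2_norm_eq_inner inner_diff_left inner_diff_right inner_commute)
  ultimately have "((\<lambda>i. (norm (f i - l))\<^sup>2) \<longlongrightarrow> 0) F" by simp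
  then have "((\<lambda>i. sqrt ((norm (f i - l))\<^sup>2)) \<longlongrightarrow> sqrt 0) F" by (rule tendsto_real_sqrt)
  then have "((\<lambda>i. norm (f i - l)) \<longlongrightarrow> 0) F" by simp
  then show ?thesis by (simp add: tendsto_norm_zero_iff LIM_zero_iff)
qed

text \<open>In \<open>ereal\<close> an unbounded family has supremum infinity, so a supremum below
  \<open>ereal C\<close> really bounds every term.\<close>

lemma le_if_SUP_ereal_less:
  assumes "(SUP (n, m). ereal (f n m)) < ereal C"
  shows "f n m \<le> C"
proof -
  have "ereal (f n m) \<le> (SUP (n, m). ereal (f n m))"
    using SUP_upper[of "(n, m)" UNIV "\<lambda>(n, m). ereal (f n m)"] by simp
  with assms have "ereal (f n m) < ereal C" by (rule order.strict_trans1[rotated])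
  then show ?thesis by simp
qed

section \<open>The discretized operators, their adjoints and the normal equations\<close>

locale discretized_equation =
  fixes A :: "'x::{real_inner, complete_space} \<Rightarrow> 'y::{real_inner, complete_space}"
    and X :: "nat \<Rightarrow> 'x set"
    and Y :: "nat \<Rightarrow> 'y set"
    and xd :: 'x
  assumes A: "bounded_linear A"
    and X_fin: "\<And>n. finite_dim_subspace (X n)"
    and X_mono: "\<And>n. X n \<subseteq> X (Suc n)"
    and X_dense: "closure (\<Union>n. X n) = UNIV"
    and Y_fin: "\<And>m. finite_dim_subspace (Y m)"
    and Y_mono: "\<And>m. Y m \<subseteq> Y (Suc m)"
    and Y_dense: "closure (\<Union>m. Y m) = UNIV"
    and xd: "xd \<in> orthogonal_comp (nullspace A)"
begin

abbreviation P where "P n \<equiv> orth_proj (X n)"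
abbreviation Q where "Q m \<equiv> orth_proj (Y m)"
abbreviation A_adj where "A_adj \<equiv> adjoint A"
abbreviation A_disc where "A_disc \<equiv> discretized_op A X Y"
abbreviation x where "x \<equiv> discretized_sol A X Y xd"

lemma lin_A: "linear A" using A by (rule bounded_linear.linear)

lemma inner_A: "inner (A v) y = inner v (A_adj y)"
  using A by (rule inner_adjoint)

lemma lin_A_adj: "linear A_adj"
  using inner_A by (intro linear_if_adjoint[of A_adj A]) (metis inner_commute)

lemma lin_P: "linear (P n)" and lin_Q: "linear (Q m)"
  using linear_orth_proj X_fin Y_fin by blast+

lemma X_le: "n \<le> n' \<Longrightarrow> X n \<subseteq> X n'" and Y_le: "m \<le> m' \<Longrightarrow> Y m \<subseteq> Y m'"
  using lift_Suc_mono_le[of X] X_mono lift_Suc_mono_le[of Y] Y_mono by blast+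

text \<open>By self-adjointness \<open>P n\<close> moves onto \<open>P n' w\<close>, which lies in
  \<open>X n'\<close>, hence in \<open>X n\<close>, and is fixed.\<close>

lemma P_P: "n' \<le> n \<Longrightarrow> P n' (P n v) = P n' v"
proof -
  assume le: "n' \<le> n"
  have "inner (P n' (P n v)) w = inner (P n' v) w" for w
    using orth_proj_ident[OF X_fin subsetD[OF X_le[OF le] orth_proj_mem[OF X_fin]]]
    by (simp add: orth_proj_self_adjoint[OF X_fin])
  then show ?thesis using vector_eq_rdot by blast
qed

lemma Q_Q: "m \<le> m' \<Longrightarrow> Q m' (Q m y) = Q m y"
  using orth_proj_ident[OF Y_fin] Y_le orth_proj_mem[OF Y_fin] by blast

lemma A_disc_apply: "A_disc n m v = Q m (A (P n v))"
  by (simp add: discretized_op_def)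

lemma inner_A_disc: "inner (A_disc n m v) y = inner v (P n (A_adj (Q m y)))"
  by (simp add: A_disc_apply orth_proj_self_adjoint[OF X_fin, symmetric]
      orth_proj_self_adjoint[OF Y_fin] inner_A)

lemma adjoint_A_disc: "adjoint (A_disc n m) = (\<lambda>y. P n (A_adj (Q m y)))"
  using inner_A_disc by (intro adjoint_unique) blast

lemma range_A_disc: "finite_dim_subspace (range (A_disc n m))"
proof -
  have "range (P n) = X n"
    by (rule range_orth_proj[OF X_fin])
  then have "range (A_disc n m) = (Q m \<circ> A) ` X n"
    unfolding discretized_op_def image_comp[symmetric] by simp
  then show ?thesis
    using finite_dim_subspace_image[OF linear_compose[OF lin_A lin_Q] X_fin] by simp
qed

lemma range_A_disc_adj: "finite_dim_subspace (range (\<lambda>y. P n (A_adj (Q m y))))"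
proof -
  have "range (Q m) = Y m"
    by (rule range_orth_proj[OF Y_fin])
  then have "range (P n \<circ> A_adj \<circ> Q m) = (P n \<circ> A_adj) ` Y m"
    unfolding image_comp[symmetric] by simp
  then show ?thesis
    using finite_dim_subspace_image[OF linear_compose[OF lin_A_adj lin_P, of n] Y_fin[of m]]
    by (simp add: comp_def)
qed

lemma sol_mem_range: "\<exists>y. x n m = P n (A_adj (Q m y))"
  using pseudoinverse_mem_range[OF inner_A_disc range_A_disc range_A_disc_adj]
  unfolding discretized_sol_def by blast

lemma P_sol: "P n (x n m) = x n m"
  using sol_mem_range[of n m] P_P[of n n] by auto

text \<open>The normal equation of the pseudoinverse simplifies: \<open>P n\<close> fixes the
  solution, and idempotence of \<open>Q m\<close> merges the discrete image and the data into one
  residual.\<close>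

lemma sol_normal_eq: "P n (A_adj (Q m (A (x n m - xd)))) = 0"
proof -
  have "P n (A_adj (Q m (A_disc n m (x n m) - A xd))) = 0"
    using pseudoinverse_normal_eq[OF inner_A_disc range_A_disc range_A_disc_adj]
    unfolding discretized_sol_def by blast
  then show ?thesis
    by (simp add: A_disc_apply P_sol linear_diff[OF lin_A] linear_diff[OF lin_Q] Q_Q)
qed

text \<open>The operator indices \<open>n'\<close>, \<open>m'\<close> are kept apart from the
  solution indices \<open>n\<close>, \<open>m\<close>: weak convergence allows them to differ,
  strong convergence sets them equal.\<close>

definition u where "u n' m' n m = pseudoinverse (adjoint (A_disc n' m')) (x n m)"

lemma inner_A_disc_adj: "inner (P n (A_adj (Q m y))) v = inner y (A_disc n m v)"
  using inner_A_disc by (metis inner_commute)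

lemma u_mem_range: "\<exists>v. u n' m' n m = A_disc n' m' v"
  using pseudoinverse_mem_range[OF inner_A_disc_adj range_A_disc_adj range_A_disc]
  unfolding u_def adjoint_A_disc by blast

lemma Q_u: "Q m' (u n' m' n m) = u n' m' n m"
  using u_mem_range[of n' m' n m] Q_Q[of m' m'] by (auto simp: A_disc_apply)

text \<open>Since \<open>X n' \<subseteq> X n\<close> and \<open>Y m \<subseteq> Y m'\<close>, the vector \<open>P n' (x n m)\<close> lies in the range of the
  adjoint of \<open>A_disc n' m'\<close>, so the least-squares problem defining \<open>u\<close> is solved with no residual.\<close>

lemma P_adj_u:
  assumes "n' \<le> n" "m \<le> m'"
  shows "P n' (A_adj (u n' m' n m)) = P n' (x n m)"
proof -
  let ?S = "\<lambda>y. P n' (A_adj (Q m' y))"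
  let ?u = "u n' m' n m"
  have Su: "P n' (A_adj ?u) = ?S ?u" by (simp add: Q_u)
  have normal: "A_disc n' m' (?S ?u - x n m) = 0"
    using pseudoinverse_normal_eq[OF inner_A_disc_adj range_A_disc_adj range_A_disc]
    unfolding u_def adjoint_A_disc by blast
  obtain y where y: "x n m = P n (A_adj (Q m y))" using sol_mem_range by blast
  then have "P n' (x n m) = ?S (Q m y)" by (simp add: P_P Q_Q assms)
  then have "?S ?u - P n' (x n m) = ?S (?u - Q m y)"
    by (simp add: linear_diff[OF lin_P] linear_diff[OF lin_Q] linear_diff[OF lin_A_adj])
  \<comment> \<open>The defect is itself an image of the adjoint, so moving the adjoint across turns
    its squared norm into a pairing with the normal equation for \<open>?u\<close>.\<close>
  then have "inner (?S ?u - P n' (x n m)) (?S ?u - P n' (x n m))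
      = inner (?u - Q m y) (A_disc n' m' (?S ?u - P n' (x n m)))"
    using inner_A_disc_adj[of n' m' "?u - Q m y" "?S ?u - P n' (x n m)"] by simp
  also have "A_disc n' m' (?S ?u - P n' (x n m)) = A_disc n' m' (?S ?u - x n m)"
    by (simp add: A_disc_apply linear_diff[OF lin_P] P_P)
  finally have "inner (?S ?u - P n' (x n m)) (?S ?u - P n' (x n m)) = 0" by (simp add: normal)
  then show ?thesis using Su by simp
qed

section \<open>Weak and strong limits of the discrete solutions\<close>

abbreviation F :: "(nat \<times> nat) filter" where "F \<equiv> sequentially \<times>\<^sub>F sequentially"

lemma P_tendsto: "filterlim N at_top F \<Longrightarrow> ((\<lambda>i. P (N i) v - v) \<longlongrightarrow> 0) F"
  using filterlim_compose[OF orth_proj_tendsto[OF X_fin X_mono X_dense]] by (simp add: LIM_zero_iff)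

lemma Q_tendsto: "filterlim M at_top F \<Longrightarrow> ((\<lambda>i. y - Q (M i) y) \<longlongrightarrow> 0) F"
  using tendsto_diff[OF tendsto_const filterlim_compose[OF orth_proj_tendsto[OF Y_fin Y_mono Y_dense]], of M F y y]
  by simp

text \<open>For \<open>w\<close> in \<open>X k\<close> and \<open>n \<ge> k\<close> the normal
  equation removes the pairing with \<open>Q m (A w)\<close>; what remains pairs a bounded family
  with \<open>A w - Q m (A w)\<close>, which tends to 0. Density of the spaces \<open>X k\<close>
  gives all \<open>w\<close>.\<close>

lemma normal_residual_weakly_null:
  assumes bdd: "\<And>n m. norm (x n m) \<le> C"
  shows "((\<lambda>(n, m). inner (A_adj (A (x n m - xd))) w) \<longlongrightarrow> 0) F"
proof -
  obtain K where K: "K \<ge> 0" "\<And>v. norm (A v) \<le> norm v * K"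
    using bounded_linear.nonneg_bounded[OF A] by blast
  have e: "norm (x n m - xd) \<le> C + norm xd" for n m
    using norm_triangle_ineq4[of "x n m" xd] bdd[of n m] by simp
  have Ae: "norm (A (x n m - xd)) \<le> (C + norm xd) * K" for n m
    using K(2)[of "x n m - xd"] mult_right_mono[OF e K(1), of n m] by linarith
  \<comment> \<open>\<open>A_adj\<close> inherits the bound \<open>K\<close> of \<open>A\<close>, by
    Cauchy-Schwarz applied to \<open>inner (A (A_adj y)) y\<close>.\<close>
  obtain L where L: "L \<ge> 0" "\<And>y. norm (A_adj y) \<le> norm y * L"
  proof
    show "K \<ge> 0" by fact
    fix y
    have "inner (A_adj y) (A_adj y) = inner (A (A_adj y)) y" by (simp add: inner_A)
    also have "\<dots> \<le> norm (A (A_adj y)) * norm y" by (rule norm_cauchy_schwarz)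
    also have "\<dots> \<le> (norm (A_adj y) * K) * norm y" by (intro mult_right_mono K) simp
    finally have "norm (A_adj y) * norm (A_adj y) \<le> norm (A_adj y) * (norm y * K)"
      by (simp add: dot_square_norm power2_eq_square algebra_simps)
    then show "norm (A_adj y) \<le> norm y * K"
      using K(1) by (cases "A_adj y = 0") (auto simp: mult_le_cancel_left)
  qed
  let ?g = "\<lambda>i::nat \<times> nat. A_adj (A (x (fst i) (snd i) - xd))"
  let ?V = "{w. ((\<lambda>i. inner (?g i) w) \<longlongrightarrow> 0) F}"
  have g: "norm (?g i) \<le> (C + norm xd) * K * L" for i
    using L(2)[of "A (x (fst i) (snd i) - xd)"] mult_right_mono[OF Ae L(1), of "fst i" "snd i"]
    by linarith
  have "X k \<subseteq> ?V" for k
  proof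
    fix w assume w: "w \<in> X k"
    have "((\<lambda>i. inner (A (x (fst i) (snd i) - xd)) (A w - Q (snd i) (A w))) \<longlongrightarrow> 0) F"
      using Ae by (intro inner_tendsto_0_bounded Q_tendsto filterlim_snd)
    moreover have "eventually (\<lambda>i. fst i \<ge> k) F"
      using filterlim_fst filterlim_at_top by blast
    then have "eventually (\<lambda>i. inner (A (x (fst i) (snd i) - xd)) (A w - Q (snd i) (A w))
        = inner (?g i) w) F"
    proof eventually_elim
      case (elim i)
      let ?e = "A (x (fst i) (snd i) - xd)"
      have "w \<in> X (fst i)" using w X_le[OF elim] by blast
      then have "inner (A_adj (Q (snd i) ?e)) w = inner (A_adj (Q (snd i) ?e)) (P (fst i) w)"
        by (simp add: orth_proj_ident[OF X_fin])
      also have "\<dots> = 0"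
        by (simp add: orth_proj_self_adjoint[OF X_fin, symmetric] sol_normal_eq)
      finally have "inner ?e (Q (snd i) (A w)) = 0"
        by (metis inner_A inner_commute orth_proj_self_adjoint[OF Y_fin])
      moreover have "inner ?e (A w) = inner (?g i) w" by (metis inner_A inner_commute)
      ultimately show ?case by (simp add: inner_diff_right)
    qed
    ultimately show "w \<in> ?V" by (auto elim: Lim_transform_eventually)
  qed
  then have "closure (\<Union>k. X k) \<subseteq> ?V"
    by (intro closure_minimal closed_subspace_weak_null(2)[OF g]) blast
  then have "w \<in> ?V" using X_dense by blast
  then show ?thesis by (simp add: case_prod_unfold)
qed

context
  fixes C :: real and nt mt :: "nat \<Rightarrow> nat \<Rightarrow> nat"
  assumes nt_lim: "filterlim (\<lambda>(n, m). nt n m) at_top F"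
    and nt: "\<And>n m. nt n m \<le> n" and mt: "\<And>n m. m \<le> mt n m"
    and x_bdd: "\<And>n m. norm (x n m) \<le> C"
    and z_bdd: "\<And>n m. norm (A_adj (u (nt n m) (mt n m) n m)) \<le> C"
begin

text \<open>By \<open>P_adj_u\<close> the projector with index \<open>nt n m\<close> annihilates the
  difference, so \<open>v\<close> may be replaced by \<open>v\<close> minus its projection, which
  tends to 0 because \<open>nt\<close> tends to infinity.\<close>

lemma adj_u_diff_weakly_null:
  "((\<lambda>(n, m). inner (x n m - A_adj (u (nt n m) (mt n m) n m)) v) \<longlongrightarrow> 0) F"
proof -
  let ?g = "\<lambda>i. x (fst i) (snd i) - A_adj (u (nt (fst i) (snd i)) (mt (fst i) (snd i)) (fst i) (snd i))"
  let ?N = "\<lambda>i. nt (fst i) (snd i)"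
  have "norm (?g i) \<le> C + C" for i
    by (rule order_trans[OF norm_triangle_ineq4 add_mono[OF x_bdd z_bdd]])
  moreover have "((\<lambda>i. P (?N i) v - v) \<longlongrightarrow> 0) F"
    using nt_lim by (intro P_tendsto) (simp add: case_prod_unfold)
  ultimately have "((\<lambda>i. - inner (?g i) (P (?N i) v - v)) \<longlongrightarrow> - 0) F"
    by (intro tendsto_minus inner_tendsto_0_bounded)
  moreover have "- inner (?g i) (P (?N i) v - v) = inner (?g i) v" for i
  proof -
    have "inner (?g i) (P (?N i) v) = inner (P (?N i) (?g i)) v"
      by (simp add: orth_proj_self_adjoint[OF X_fin])
    also have "P (?N i) (?g i) = 0" by (simp add: linear_diff[OF lin_P] P_adj_u nt mt)
    finally show ?thesis by (simp add: inner_diff_right)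
  qed
  ultimately show ?thesis by (simp add: case_prod_unfold)
qed

lemma sol_weak_limit: "((\<lambda>(n, m). inner (x n m - xd) v) \<longlongrightarrow> 0) F"
proof -
  let ?g = "\<lambda>i. x (fst i) (snd i) - xd"
  let ?V = "{v. ((\<lambda>i. inner (?g i) v) \<longlongrightarrow> 0) F}"
  have g: "norm (?g i) \<le> C + norm xd" for i
    by (rule order_trans[OF norm_triangle_ineq4 add_mono[OF x_bdd order_refl]])
  \<comment> \<open>Both \<open>xd\<close> and all values of \<open>A_adj\<close> are orthogonal to
    \<open>w\<close>, so \<open>xd\<close> can be exchanged for the adjoint image of
    \<open>u\<close>.\<close>
  have null: "w \<in> ?V" if "A w = 0" for w
  proof -
    have "inner (A_adj y) w = 0" for y using inner_A[of w y] that by (simp add: inner_commute)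
    moreover have "inner xd w = 0"
      using xd that by (auto simp: orthogonal_comp_def orthogonal_def nullspace_def inner_commute)
    ultimately show ?thesis
      using adj_u_diff_weakly_null[of w] by (simp add: case_prod_unfold inner_diff_left)
  qed
  have range: "A_adj (A w) \<in> ?V" for w
  proof -
    have "inner (?g i) (A_adj (A w)) = inner (A_adj (A (?g i))) w" for i
      by (metis inner_A inner_commute)
    then show ?thesis using normal_residual_weakly_null[OF x_bdd, of w]
      by (simp add: case_prod_unfold)
  qed
  \<comment> \<open>In place of a separate density proof, \<open>v\<close> is projected onto
    \<open>?V\<close>: \<open>v - p\<close> is orthogonal to every \<open>A_adj (A w)\<close>, so
    \<open>A\<close> annihilates it; then it lies in \<open>?V\<close> and is orthogonal to
    itself.\<close>
  obtain p where p: "p \<in> ?V" "\<And>s. s \<in> ?V \<Longrightarrow> inner (v - p) s = 0"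
    using closed_subspace_projection[OF closed_subspace_weak_null[of ?g, OF g], of F v] by blast
  have "inner (A (v - p)) (A (v - p)) = 0" using p(2)[OF range] by (simp add: inner_A)
  then have "v - p \<in> ?V" by (intro null) simp
  from p(2)[OF this] have "v = p" by simp
  with p(1) show ?thesis by (simp add: case_prod_unfold)
qed

end

lemma sol_strong_limit:
  assumes x_bdd: "\<And>n m. norm (x n m) \<le> C"
    and z_bdd: "\<And>n m. norm (A_adj (u n m n m)) \<le> C"
  shows "((\<lambda>(n, m). x n m) \<longlongrightarrow> xd) F"
proof -
  have fst: "filterlim (\<lambda>(n, m). n) at_top F"
    using filterlim_fst by (simp add: case_prod_unfold)
  have weak: "((\<lambda>i. inner (x (fst i) (snd i)) xd) \<longlongrightarrow> inner xd xd) F"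
    using sol_weak_limit[OF fst _ _ x_bdd, of "\<lambda>n m. m" xd] z_bdd
    by (simp add: case_prod_unfold inner_diff_left LIM_zero_iff)
  have "((\<lambda>i. inner (x (fst i) (snd i) - A_adj (u (fst i) (snd i) (fst i) (snd i))) xd) \<longlongrightarrow> 0) F"
    using adj_u_diff_weakly_null[OF fst _ _ x_bdd, of "\<lambda>n m. m" xd] z_bdd
    by (simp add: case_prod_unfold)
  from tendsto_diff[OF weak this]
  have "((\<lambda>i. inner (A_adj (u (fst i) (snd i) (fst i) (snd i))) xd) \<longlongrightarrow> inner xd xd) F"
    by (simp add: inner_diff_left)
  \<comment> \<open>With equal indices \<open>u\<close> lies in the range of
    \<open>A_disc n m\<close>, so the normal equation lets \<open>x n m\<close> replace
    \<open>xd\<close>; then \<open>P_adj_u\<close> turns the projected \<open>A_adj\<close> image of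
    \<open>u\<close> into \<open>x n m\<close>.\<close>
  moreover have "inner (A_adj (u n m n m)) xd = inner (x n m) (x n m)" for n m
  proof -
    obtain v where v: "u n m n m = A_disc n m v" using u_mem_range by blast
    have "inner (A (x n m - xd)) (u n m n m) = inner (P n (A_adj (Q m (A (x n m - xd))))) v"
      unfolding v by (simp add: inner_A_disc_adj)
    then have "inner (x n m - xd) (A_adj (u n m n m)) = 0" by (simp add: sol_normal_eq inner_A)
    then have "inner (A_adj (u n m n m)) xd = inner (x n m) (A_adj (u n m n m))"
      by (simp add: inner_diff_left inner_commute)
    also have "\<dots> = inner (P n (x n m)) (A_adj (u n m n m))" by (simp add: P_sol)
    also have "\<dots> = inner (x n m) (P n (A_adj (u n m n m)))"
      by (rule orth_proj_self_adjoint[OF X_fin])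
    also have "\<dots> = inner (x n m) (x n m)" by (simp add: P_adj_u P_sol)
    finally show ?thesis .
  qed
  ultimately show ?thesis
    using tendsto_if_weak_and_norm[OF weak] by (simp add: case_prod_unfold)
qed

end

theorem proposition27:
  fixes A :: "'x::{real_inner, complete_space} \<Rightarrow> 'y::{real_inner, complete_space}"
    and X :: "nat \<Rightarrow> 'x set"
    and Y :: "nat \<Rightarrow> 'y set"
    and xd :: 'x
  assumes "bounded_linear A"
    and "\<And>n. finite_dim_subspace (X n)"
    and "\<And>n. X n \<subseteq> X (Suc n)"
    and "closure (\<Union>n. X n) = UNIV"
    and "\<And>m. finite_dim_subspace (Y m)"
    and "\<And>m. Y m \<subseteq> Y (Suc m)"
    and "closure (\<Union>m. Y m) = UNIV"
    and "xd \<in> orthogonal_comp (nullspace A)"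
  shows
    "((\<exists>(C::real) (nt :: nat \<Rightarrow> nat \<Rightarrow> nat) (mt :: nat \<Rightarrow> nat \<Rightarrow> nat).
        filterlim (\<lambda>(n, m). nt n m) at_top (sequentially \<times>\<^sub>F sequentially) \<and>
        (\<forall>n m. mt n m \<ge> m \<and> nt n m \<le> n) \<and>
        (SUP (n, m). ereal (norm (discretized_sol A X Y xd n m))) < ereal C \<and>
        (SUP (n, m). ereal (norm (adjoint A
            (pseudoinverse (adjoint (discretized_op A X Y (nt n m) (mt n m)))
              (discretized_sol A X Y xd n m))))) < ereal C)
      \<longrightarrow> weakly_tendsto (\<lambda>(n, m). discretized_sol A X Y xd n m) xd
            (sequentially \<times>\<^sub>F sequentially))
    \<and> ((\<exists>C::real.
        (SUP (n, m). ereal (norm (discretized_sol A X Y xd n m))) < ereal C \<and>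
        (SUP (n, m). ereal (norm (adjoint A
            (pseudoinverse (adjoint (discretized_op A X Y n m))
              (discretized_sol A X Y xd n m))))) < ereal C)
      \<longrightarrow> ((\<lambda>(n, m). discretized_sol A X Y xd n m) \<longlongrightarrow> xd)
            (sequentially \<times>\<^sub>F sequentially))"
proof (intro conjI impI; (elim exE conjE)?)
  interpret discretized_equation A X Y xd
    by (rule discretized_equation.intro[OF assms])
  {
    fix C nt mt
    assume lim: "filterlim (\<lambda>(n, m). nt n m) at_top (sequentially \<times>\<^sub>F sequentially)"
      and idx: "\<forall>n m. m \<le> mt n m \<and> nt n m \<le> n"
      and x: "(SUP (n, m). ereal (norm (discretized_sol A X Y xd n m))) < ereal C"
      and z: "(SUP (n, m). ereal (norm (adjoint A
            (pseudoinverse (adjoint (discretized_op A X Y (nt n m) (mt n m)))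
              (discretized_sol A X Y xd n m))))) < ereal C"
    show "weakly_tendsto (\<lambda>(n, m). discretized_sol A X Y xd n m) xd
        (sequentially \<times>\<^sub>F sequentially)"
      using sol_weak_limit[OF lim _ _ le_if_SUP_ereal_less[OF x]
          le_if_SUP_ereal_less[OF z, folded u_def]] idx
      by (intro weakly_tendsto_if_inner_tendsto) (simp add: case_prod_unfold)
  next
    fix C
    assume x: "(SUP (n, m). ereal (norm (discretized_sol A X Y xd n m))) < ereal C"
      and z: "(SUP (n, m). ereal (norm (adjoint A
            (pseudoinverse (adjoint (discretized_op A X Y n m))
              (discretized_sol A X Y xd n m))))) < ereal C"
    show "((\<lambda>(n, m). discretized_sol A X Y xd n m) \<longlongrightarrow> xd) (sequentially \<times>\<^sub>F sequentially)"
      by (rule sol_strong_limit[OF le_if_SUP_ereal_less[OF x]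
          le_if_SUP_ereal_less[OF z, folded u_def]])
  }
qed

end
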